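(* For any integer $k \ge 4$, every oriented graph $G$ with $\delta^{\pm}_{*}(G) > \frac{1}{2}\left(k-1+\sqrt{k-3}\right)$ contains each antipath of length $k$ (as a subgraph).
   Context: An oriented graph is a loopless graph in which every edge is given an orientation, such that for any two vertices $u,v$ at most one of $uv$, $vu$ is an edge. For a vertex $v$, $d^+(v)$ (out-degree) is the number of vertices $w$ with $vw\in E(G)$ and $d^-(v)$ (in-degree) is the number of vertices $u$ with $uv \in E(G)$. The minimum pseudo-semidegree $\delta^{\pm}_{*}(G)$ is defined as follows: if $G$ has no edges then $\delta^{\pm}_{*}(G)=0$; otherwise $\delta^{\pm}_{*}(G)$ is the largest integer $d$ such that every vertex has out-degree either $0$ or at least $d$, and in-degree either $0$ or at least $d$. An antidirected path (antipath) is an orientation of a path such that every vertex of the path has in-degree $0$ or out-degree $0$ within the path; its length is its number of edges. (For even length there are two non-isomorphic antipaths; the claim is that all antipaths of length $k$ appear.) *)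

theory Defs
  imports
    Complex_Main
    "Graph_Theory.Pair_Digraph"
    "Graph_Theory.Digraph_Isomorphism"
begin

text \<open>As usual, graphs are finite: \<^locale>\<open>pair_digraph\<close> consists of finite loopless digraphs
  whose arcs are pairs of vertices, so there are no parallel arcs.\<close>

locale oriented_graph = pair_digraph G for G :: "'a pair_pre_digraph" +
  assumes no_opposite_arcs: "(u, v) \<in> parcs G \<Longrightarrow> (v, u) \<notin> parcs G"

definition pseudo_semidegree_ge :: "'a pair_pre_digraph \<Rightarrow> nat \<Rightarrow> bool" where
  "pseudo_semidegree_ge G d \<longleftrightarrow>
     (\<forall>v \<in> pverts G. (out_degree G v = 0 \<or> d \<le> out_degree G v) \<and>
                    (in_degree G v = 0 \<or> d \<le> in_degree G v))"

text \<open>Ranging over \<^typ>\<open>nat\<close> loses nothing, since \<open>d = 0\<close> always qualifies. The maximum exists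
  as soon as a finite digraph has an arc; see \<open>le_min_pseudo_semidegree_iff\<close> below.\<close>

definition min_pseudo_semidegree :: "'a pair_pre_digraph \<Rightarrow> nat" where
  "min_pseudo_semidegree G =
     (if parcs G = {} then 0 else (GREATEST d. pseudo_semidegree_ge G d))"

definition is_orientation_of_path :: "'a pair_pre_digraph \<Rightarrow> 'a list \<Rightarrow> bool" where
  "is_orientation_of_path P p \<longleftrightarrow>
     oriented_graph P \<and> p \<noteq> [] \<and> distinct p \<and> pverts P = set p \<and>
     {{u, v} | u v. (u, v) \<in> parcs P} = {{p ! i, p ! Suc i} | i. Suc i < length p}"

text \<open>\<open>antipath k P\<close>: the digraph \<open>P\<close> is an antidirected path with \<open>k\<close> edges, hence with
  \<open>k + 1\<close> vertices.\<close>

definition antipath :: "nat \<Rightarrow> 'a pair_pre_digraph \<Rightarrow> bool" where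
  "antipath k P \<longleftrightarrow>
     (\<exists>p. is_orientation_of_path P p \<and> length p = Suc k) \<and>
     (\<forall>v \<in> pverts P. in_degree P v = 0 \<or> out_degree P v = 0)"

definition contains_copy :: "'a pair_pre_digraph \<Rightarrow> 'b pair_pre_digraph \<Rightarrow> bool" where
  "contains_copy G P \<longleftrightarrow>
     (\<exists>H :: 'a pair_pre_digraph. subgraph (with_proj H) (with_proj G) \<and>
                                 digraph_iso (with_proj P) (with_proj H))"

lemma (in pair_fin_digraph) le_min_pseudo_semidegree_iff:
  assumes "parcs G \<noteq> {}"
  shows "d \<le> min_pseudo_semidegree G \<longleftrightarrow> pseudo_semidegree_ge G d"
proof -
  obtain u v where uv: "(u, v) \<in> parcs G" using assms by auto
  then have "u \<in> pverts G" by (rule in_arcsD1)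
  have "(u, v) \<in> out_arcs G u" using uv by simp
  moreover have "finite (out_arcs G u)"
    by (rule finite_subset[of _ "parcs G"]) (auto simp: out_arcs_def pair_finite_arcs)
  ultimately have pos: "out_degree G u \<noteq> 0" unfolding out_degree_def by (metis card_0_eq empty_iff)
  have bound: "\<And>e. pseudo_semidegree_ge G e \<Longrightarrow> e \<le> out_degree G u"
    using pos \<open>u \<in> pverts G\<close> by (auto simp: pseudo_semidegree_ge_def)
  have zero: "pseudo_semidegree_ge G 0" by (simp add: pseudo_semidegree_ge_def)
  have eq: "min_pseudo_semidegree G = (GREATEST d. pseudo_semidegree_ge G d)"
    using assms by (simp add: min_pseudo_semidegree_def)
  have "pseudo_semidegree_ge G (min_pseudo_semidegree G)"
    unfolding eq by (rule GreatestI_nat[of _ 0 "out_degree G u"]) (auto simp: zero bound)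
  moreover have "d \<le> min_pseudo_semidegree G" if "pseudo_semidegree_ge G d"
    unfolding eq using that bound by (rule Greatest_le_nat)
  ultimately show ?thesis
    unfolding pseudo_semidegree_ge_def using le_trans by blast
qed

end

theory Submission
  imports Defs
begin

text \<open>An antipath with an odd number of vertices has either two sources or two sinks as its ends. Let
  \<open>x\<^sub>0 y\<^sub>0 x\<^sub>1 \<dots> y\<^sub>n\<^sub>-\<^sub>1 x\<^sub>n\<close> be one with sources \<open>x\<^sub>i\<close>. If \<open>x\<^sub>0\<close> and \<open>x\<^sub>n\<close> have together more than \<open>2n\<close>
  out-neighbours on it, then for some \<open>j\<close> it has the arcs \<open>x\<^sub>0 x\<^sub>j\<^sub>+\<^sub>1\<close> and \<open>x\<^sub>n y\<^sub>j\<close>, up to reversal, and a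
  rotation gives such an antipath on the same vertices with an arc from the first vertex to the
  last vertex \<open>z\<close>. Putting \<open>z\<close> in front instead turns it into an antipath whose ends are sinks.
  So \<open>z\<close> is an end of an antipath on this vertex set both as a source and as a sink.

  This settles an odd number \<open>k\<close> of arcs: for a maximal antipath on \<open>k\<close> vertices with sources as ends,
  all out-neighbours of \<open>z\<close> lie on it, hence some in-neighbour does not, and it prolongs the antipath
  with sinks as ends. It also shows that for even \<open>k\<close> one type of antipath yields the other.

  For even \<open>k\<close>, suppose that there is no antipath of length \<open>k\<close>, and take one on \<open>k - 1\<close> vertices.
  If an end is a sink, its in-neighbours outside have all their out-neighbours on the antipath, and
  two of them can be inserted at once unless their out-neighbourhoods avoid each other in a certain
  way. As \<open>k\<close> is small compared with the square of the excess of the degrees over \<open>k/2\<close>, there are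
  few such in-neighbours, and dually for ends that are sources. But then \<open>z\<close> has too few neighbours
  outside in both directions.\<close>

section \<open>Alternating lists\<close>

definition opp :: "('a \<Rightarrow> 'a \<Rightarrow> bool) \<Rightarrow> 'a \<Rightarrow> 'a \<Rightarrow> bool" where
  "opp r x y \<longleftrightarrow> r y x"

lemma opp_opp [simp]: "opp (opp r) = r"
  by (simp add: opp_def fun_eq_iff)

text \<open>Relation that a list alternating for \<open>r\<close> satisfies between positions
  \<open>n\<close> and \<open>n + 1\<close>.\<close>

definition orient :: "('a \<Rightarrow> 'a \<Rightarrow> bool) \<Rightarrow> nat \<Rightarrow> 'a \<Rightarrow> 'a \<Rightarrow> bool" where
  "orient r n = (if even n then r else (opp r))"

lemma orient_simps [simp]:
  "even n \<Longrightarrow> orient r n = r"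
  "odd n \<Longrightarrow> orient r n = (opp r)"
  by (simp_all add: orient_def)

lemma orient_opp: "orient (opp r) n = orient r (Suc n)"
  by (simp add: orient_def)

text \<open>The first vertex is a source, so antipaths starting in a sink are those alternating for
  \<^term>\<open>opp r\<close>.\<close>

fun alternating :: "('a \<Rightarrow> 'a \<Rightarrow> bool) \<Rightarrow> 'a list \<Rightarrow> bool" where
  "alternating r [] \<longleftrightarrow> True"
| "alternating r [x] \<longleftrightarrow> True"
| "alternating r (x # y # xs) \<longleftrightarrow> r x y \<and> alternating (opp r) (y # xs)"

lemma alternating_append:
  "alternating r (xs @ ys) \<longleftrightarrow>
     alternating r xs \<and> alternating (orient r (length xs)) ys \<and>
     (xs = [] \<or> ys = [] \<or> orient r (length xs - 1) (last xs) (hd ys))"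
proof (induction r xs rule: alternating.induct)
  case (2 r x)
  then show ?case by (cases ys) auto
next
  case (3 r x y xs)
  then show ?case by (auto simp: orient_opp) 
qed simp

lemma alternating_Cons:
  "alternating r (x # xs) \<longleftrightarrow> alternating (opp r) xs \<and> (xs = [] \<or> r x (hd xs))"
  by (cases xs) auto

text \<open>The last vertex has index \<open>length xs - 1\<close>, of the same parity as
  \<open>Suc (length xs)\<close>, and this parity decides whether it is a source or a sink. With an
  odd number of vertices, reversal keeps the type.\<close>

lemma alternating_rev: "alternating r (rev xs) \<longleftrightarrow> alternating (orient r (Suc (length xs))) xs"
proof (induction xs arbitrary: r)
  case (Cons x xs)
  then show ?case
    using opp_def[of r x "hd xs"] opp_def[of r "hd xs" x]
    by (auto simp: alternating_append alternating_Cons last_rev orient_def split: if_splits)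
qed simp

lemma alternating_iff_nth:
  "alternating r xs \<longleftrightarrow> (\<forall>i. Suc i < length xs \<longrightarrow> orient r i (xs ! i) (xs ! Suc i))"
proof (induction r xs rule: alternating.induct)
  case (3 r x y xs)
  show ?case
    unfolding alternating.simps 3 by (auto simp: orient_opp All_less_Suc2 nth_Cons split: nat.split)
qed auto

lemma alternating_take: "alternating r xs \<Longrightarrow> alternating r (take n xs)"
  by (metis alternating_append append_take_drop_id)

lemma alternating_drop: "alternating r xs \<Longrightarrow> n \<le> length xs \<Longrightarrow> alternating (orient r n) (drop n xs)"
  by (metis alternating_append append_take_drop_id length_take min.absorb2)

lemma alternating_butlast: "alternating r xs \<Longrightarrow> alternating r (butlast xs)"
  by (simp add: butlast_conv_take alternating_take)

section \<open>Vertices attached to the end of an antipath\<close>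

text \<open>Next to a positive term all others are at most 0. Pairing it with one of them already
  gives the bound \<open>B\<close>, and the rest can only lower the sum.\<close>

lemma sum_le_if_pairwise:
  fixes g :: "'w \<Rightarrow> int"
  assumes "finite Z" "2 \<le> card Z" "0 \<le> B"
    and pair: "\<And>v w. v \<in> Z \<Longrightarrow> w \<in> Z \<Longrightarrow> v \<noteq> w \<Longrightarrow> 1 \<le> g v \<Longrightarrow> g w \<le> 0 \<and> g v + g w \<le> B"
  shows "sum g Z \<le> B"
proof (cases "\<exists>v\<in>Z. 1 \<le> g v")
  case True
  then obtain v where v: "v \<in> Z" "1 \<le> g v" by auto
  have "card (Z - {v}) \<ge> 1"
    using assms(1,2) v by simp
  then obtain w where w: "w \<in> Z" "w \<noteq> v"
    by (metis Diff_iff card.empty ex_in_conv insertI1 not_one_le_zero)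
  have "sum g Z = g v + (g w + sum g (Z - {v} - {w}))"
    using assms(1) v w by (simp add: sum.remove)
  moreover have "sum g (Z - {v} - {w}) \<le> 0"
    by (rule sum_nonpos) (use pair[OF v(1) _ _ v(2)] in auto)
  ultimately show ?thesis using pair[OF v(1) w(1) _ v(2)] w(2) by auto
next
  case False
  then have "sum g Z \<le> 0" by (intro sum_nonpos) force
  then show ?thesis using assms(3) by simp
qed

lemma twice_sum_le:
  fixes C :: "nat \<Rightarrow> int"
  assumes "C 0 \<le> 0" "C m \<le> 0" "\<And>j. j < m \<Longrightarrow> C j + C (Suc j) \<le> 1"
  shows "2 * (\<Sum>j\<le>m. C j) \<le> int m"
proof -
  have "2 * (\<Sum>j\<le>m. C j) = C 0 + (\<Sum>j<m. C j + C (Suc j)) + C m"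
    by (induction m) auto
  also have "(\<Sum>j<m. C j + C (Suc j)) \<le> (\<Sum>j<m. 1)"
    by (rule sum_mono) (use assms(3) in auto)
  finally show ?thesis using assms(1,2) by simp
qed

text \<open>For an antipath \<open>y\<^sub>0 x\<^sub>0 y\<^sub>1 \<dots> x\<^sub>n\<^sub>-\<^sub>1 y\<^sub>n\<close> and outside vertices \<open>w\<close> with an arc to \<open>y\<^sub>0\<close>, read
  \<open>a w j\<close> as an arc from \<open>w\<close> to \<open>y\<^sub>j\<close> and \<open>b w j\<close> as an arc from \<open>w\<close> to \<open>x\<^sub>j\<close>. The total surplus \<open>C j\<close> over one
  out-neighbour per block \<open>{x\<^sub>j, y\<^sub>j\<^sub>+\<^sub>1}\<close> is at most 1 on any two consecutive blocks.\<close>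

lemma few_coattached:
  fixes a b :: "'w \<Rightarrow> nat \<Rightarrow> bool"
  assumes Z: "finite Z" "2 \<le> card Z"
    and first: "\<And>w. w \<in> Z \<Longrightarrow> a w 0"
    and last: "\<And>w. w \<in> Z \<Longrightarrow> \<not> a w n"
    and excl: "\<And>v w j. v \<in> Z \<Longrightarrow> w \<in> Z \<Longrightarrow> v \<noteq> w \<Longrightarrow> j < n \<Longrightarrow> b v j \<Longrightarrow> a w (Suc j) \<Longrightarrow>
                  \<not> b w j \<and> \<not> a w j"
    and large: "\<And>w. w \<in> Z \<Longrightarrow> n + 1 + e \<le> (\<Sum>j\<le>n. of_bool (a w j)) + (\<Sum>j<n. of_bool (b w j))"
  shows "2 * (card Z * e) < n"
proof -
  have "Z \<noteq> {}" using Z by auto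
  then have "n \<noteq> 0" using first last by auto
  then obtain m where m: "n = Suc m" using not0_implies_Suc by blast
  define c :: "'w \<Rightarrow> nat \<Rightarrow> int" where "c w j = of_bool (b w j) + of_bool (a w (Suc j)) - 1" for w j
  define C where "C j = (\<Sum>w\<in>Z. c w j)" for j
  \<comment> \<open>All of \<open>Z\<close> has an arc to index 0 of \<open>a\<close>, so by
    \<open>excl\<close> a \<open>v\<close> with both arcs into the first block leaves none there to
    any other \<open>w\<close>.\<close>
  have 0: "C 0 \<le> 0" unfolding C_def
  proof (rule sum_le_if_pairwise[OF Z])
    fix v w assume "v \<in> Z" "w \<in> Z" "v \<noteq> w" "1 \<le> c v 0"
    then show "c w 0 \<le> 0 \<and> c v 0 + c w 0 \<le> 0"
      using excl[of v w 0] excl[of w v 0] first[of w] m by (auto simp: c_def of_bool_def split: if_splits)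
  qed simp
  have 1: "C m \<le> 0" unfolding C_def
    by (rule sum_nonpos) (use last m in \<open>auto simp: c_def\<close>)
  \<comment> \<open>If \<open>v\<close> sends at least three arcs into two consecutive blocks, then
    \<open>v\<close> and \<open>w\<close> together send at most five, four of which are no
    surplus.\<close>
  have 2: "C j + C (Suc j) \<le> 1" if "j < m" for j
    unfolding C_def sum.distrib[symmetric]
  proof (rule sum_le_if_pairwise[OF Z])
    fix v w assume vw: "v \<in> Z" "w \<in> Z" "v \<noteq> w" and 1: "1 \<le> c v j + c v (Suc j)"
    have j: "j < n" "Suc j < n" using that m by auto
    have "\<not> (b v j \<and> a w (Suc j) \<and> b w j)" "\<not> (b w j \<and> a v (Suc j) \<and> b v j)"
      "\<not> (b v (Suc j) \<and> a w (Suc (Suc j)) \<and> (b w (Suc j) \<or> a w (Suc j)))"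
      "\<not> (b w (Suc j) \<and> a v (Suc (Suc j)) \<and> (b v (Suc j) \<or> a v (Suc j)))"
      using excl[OF vw j(1)] excl[OF vw(2,1) vw(3)[symmetric] j(1)]
        excl[OF vw j(2)] excl[OF vw(2,1) vw(3)[symmetric] j(2)] by blast+
    with 1 show "c w j + c w (Suc j) \<le> 0 \<and> c v j + c v (Suc j) + (c w j + c w (Suc j)) \<le> 1"
      unfolding c_def of_bool_def by (smt (verit))
  qed simp
  have "int e \<le> (\<Sum>j\<le>m. c w j)" if "w \<in> Z" for w
  proof -
    \<comment> \<open>The arc to index 0 lies in no block, which uses up the 1 in
      \<open>n + 1 + e\<close>.\<close>
    have "(\<Sum>j\<le>n. of_bool (a w j)) = 1 + (\<Sum>j\<le>m. of_bool (a w (Suc j)) :: int)"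
      unfolding m by (subst sum.atMost_Suc_shift) (simp add: first that)
    then have "(\<Sum>j\<le>m. c w j) = (\<Sum>j\<le>n. of_bool (a w j)) + (\<Sum>j<n. of_bool (b w j)) - int n - 1"
      unfolding m by (simp add: c_def sum.distrib sum_subtractf lessThan_Suc_atMost)
    also have "\<dots> = int ((\<Sum>j\<le>n. of_bool (a w j)) + (\<Sum>j<n. of_bool (b w j))) - int n - 1"
      by simp
    finally show ?thesis using large[OF that] by linarith
  qed
  then have "(\<Sum>w\<in>Z. int e) \<le> (\<Sum>w\<in>Z. \<Sum>j\<le>m. c w j)" by (rule sum_mono)
  also have "\<dots> = (\<Sum>j\<le>m. C j)" unfolding C_def by (rule sum.swap)
  finally have "2 * (int (card Z) * int e) \<le> int m"
    using twice_sum_le[of C m, OF 0 1 2] by simp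
  then show ?thesis using m by (metis less_Suc_eq_le of_nat_le_iff of_nat_mult of_nat_numeral)
qed

section \<open>Closing an antipath\<close>

lemma sum_odd_even:
  fixes f :: "nat \<Rightarrow> nat"
  shows "(\<Sum>i<2 * n + 1. f i) = (\<Sum>j\<le>n. f (2 * j)) + (\<Sum>j<n. f (2 * j + 1))"
  by (induction n) auto

lemma card_filter_odd_even:
  assumes "distinct xs" "length xs = 2 * n + 1"
  shows "card {v \<in> set xs. p v} =
           (\<Sum>j\<le>n. of_bool (p (xs ! (2 * j)))) + (\<Sum>j<n. of_bool (p (xs ! (2 * j + 1))))"
proof -
  have "card {v \<in> set xs. p v} = (\<Sum>v\<in>set xs. of_bool (p v))"
    by (simp add: Int_def)
  also have "\<dots> = (\<Sum>i<length xs. of_bool (p (xs ! i)))"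
    by (rule sum.reindex_bij_betw[OF bij_betw_nth[OF assms(1) refl refl], symmetric])
  finally show ?thesis unfolding assms(2) sum_odd_even .
qed

text \<open>The part from position \<open>2 * j + 2\<close> on is reversed. It has odd length, so it
  keeps its type; the arc from the old last vertex to position \<open>2 * j + 1\<close> joins the
  pieces, and the out-neighbour of the first vertex becomes the end.\<close>

lemma closing_rotation:
  assumes "distinct xs" "alternating r xs" "length xs = 2 * n + 1" "j < n"
    and "r (xs ! 0) (xs ! (2 * j + 2))" "r (xs ! (2 * n)) (xs ! (2 * j + 1))"
  shows "\<exists>ys. distinct ys \<and> alternating r ys \<and> set ys = set xs \<and> length ys = length xs \<and>
              r (hd ys) (last ys)"
proof (intro exI conjI)
  let ?k = "2 * j + 2"
  let ?ys = "take ?k xs @ rev (drop ?k xs)"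
  have k: "?k < length xs" using assms(3,4) by simp
  have last: "last xs = xs ! (2 * n)" using assms(3) last_conv_nth[of xs] by force
  have "last (take ?k xs) = xs ! (2 * j + 1)"
    using k by (subst last_conv_nth) auto
  moreover have "hd (rev (drop ?k xs)) = xs ! (2 * n)"
    using k last by (simp add: hd_rev)
  moreover have "alternating r (rev (drop ?k xs))"
    using alternating_drop[OF assms(2), of ?k] k assms(3,4) by (simp add: alternating_rev)
  ultimately show "alternating r ?ys"
    using k assms(2,6) by (simp add: alternating_append alternating_take opp_def)
  have "set (take ?k xs) \<union> set (drop ?k xs) = set xs"
    by (metis append_take_drop_id set_append)
  then show "set ?ys = set xs" by simp
  show len: "length ?ys = length xs" using k by simp
  then show "distinct ?ys"
    using \<open>set ?ys = set xs\<close> assms(1) by (metis card_distinct distinct_card)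
  have "hd ?ys = xs ! 0" using k by (cases xs) auto
  moreover have "last ?ys = xs ! ?k" using k by (simp add: last_rev hd_drop_conv_nth)
  ultimately show "r (hd ?ys) (last ?ys)" using assms(5) by simp
qed

text \<open>The \<open>4 * n\<close> possible arcs from the two ends into the antipath fall into
  \<open>2 * n\<close> pairs, each of which allows a rotation of the list or of its reverse. More
  than \<open>2 * n\<close> arcs fill some pair.\<close>

lemma ex_closing_rotation:
  assumes "distinct xs" "alternating r xs" "length xs = 2 * n + 1" "\<And>v. \<not> r v v"
    and large: "2 * n < card {v \<in> set xs. r (hd xs) v} + card {v \<in> set xs. r (last xs) v}"
  shows "\<exists>ys. distinct ys \<and> alternating r ys \<and> set ys = set xs \<and> length ys = length xs \<and>
              r (hd ys) (last ys)"
proof (rule ccontr)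
  assume no: "\<not> ?thesis"
  have 1: "\<not> (r (xs ! 0) (xs ! (2 * j + 2)) \<and> r (xs ! (2 * n)) (xs ! (2 * j + 1)))" if "j < n" for j
    using closing_rotation[OF assms(1-3) that] no by blast
  have 2: "\<not> (r (xs ! (2 * n)) (xs ! (2 * j)) \<and> r (xs ! 0) (xs ! (2 * j + 1)))" if "j < n" for j
  proof -
    have "rev xs ! 0 = xs ! (2 * n)" "rev xs ! (2 * n) = xs ! 0"
      "rev xs ! (2 * (n - 1 - j) + 2) = xs ! (2 * j)"
      "rev xs ! (2 * (n - 1 - j) + 1) = xs ! (2 * j + 1)"
      using assms(3) that by (auto simp: rev_nth intro!: arg_cong[of _ _ "(!) xs"])
    then show ?thesis
      using closing_rotation[of "rev xs" r n "n - 1 - j"] assms(1-3) no that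
      by (auto simp: alternating_rev)
  qed
  have hd: "hd xs = xs ! 0" and last: "last xs = xs ! (2 * n)"
    using assms(3) hd_conv_nth[of xs] last_conv_nth[of xs] by force+
  have "(\<Sum>j\<le>n. of_bool (r (xs ! 0) (xs ! (2 * j)))) =
        (\<Sum>j<n. of_bool (r (xs ! 0) (xs ! (2 * j + 2))) :: nat)"
    by (subst sum.atMost_shift) (simp add: assms(4))
  then have "card {v \<in> set xs. r (hd xs) v} =
      (\<Sum>j<n. of_bool (r (xs ! 0) (xs ! (2 * j + 2)))) + (\<Sum>j<n. of_bool (r (xs ! 0) (xs ! (2 * j + 1))))"
    unfolding hd card_filter_odd_even[OF assms(1,3)] by simp
  moreover have "(\<Sum>j\<le>n. of_bool (r (xs ! (2 * n)) (xs ! (2 * j)))) =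
        (\<Sum>j<n. of_bool (r (xs ! (2 * n)) (xs ! (2 * j))) :: nat)"
    by (simp add: lessThan_Suc_atMost[symmetric] assms(4))
  then have "card {v \<in> set xs. r (last xs) v} =
      (\<Sum>j<n. of_bool (r (xs ! (2 * n)) (xs ! (2 * j)))) + (\<Sum>j<n. of_bool (r (xs ! (2 * n)) (xs ! (2 * j + 1))))"
    unfolding last card_filter_odd_even[OF assms(1,3)] by simp
  ultimately have "card {v \<in> set xs. r (hd xs) v} + card {v \<in> set xs. r (last xs) v} =
     (\<Sum>j<n. of_bool (r (xs ! 0) (xs ! (2 * j + 2))) + of_bool (r (xs ! (2 * n)) (xs ! (2 * j + 1)))) +
     (\<Sum>j<n. of_bool (r (xs ! (2 * n)) (xs ! (2 * j))) + of_bool (r (xs ! 0) (xs ! (2 * j + 1))))"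
    by (simp add: sum.distrib)
  also have "\<dots> \<le> (\<Sum>j<n. 1) + (\<Sum>j<n. 1)"
    by (intro add_mono sum_mono) (use 1 2 in \<open>auto simp: of_bool_def\<close>)
  finally show False using large by simp
qed

lemma alternating_last_Cons_butlast:
  assumes "distinct xs" "alternating r xs" "2 \<le> length xs" "r (hd xs) (last xs)"
  shows "distinct (last xs # butlast xs)" "alternating (opp r) (last xs # butlast xs)"
    "set (last xs # butlast xs) = set xs"
proof -
  obtain ys z where xs: "xs = ys @ [z]"
    using assms(3) by (cases xs rule: rev_cases) auto
  moreover have "ys \<noteq> []" using assms(3) xs by auto
  ultimately show "distinct (last xs # butlast xs)" "alternating (opp r) (last xs # butlast xs)"
    "set (last xs # butlast xs) = set xs"
    using assms by (auto simp: alternating_Cons alternating_append opp_def)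
qed

section \<open>Antipaths in relations of large semidegree\<close>

text \<open>Here \<open>n\<close> counts vertices.\<close>

definition has_antipath :: "('a \<Rightarrow> 'a \<Rightarrow> bool) \<Rightarrow> nat \<Rightarrow> bool" where
  "has_antipath r n \<longleftrightarrow> (\<exists>xs. length xs = n \<and> distinct xs \<and> alternating r xs)"

lemma has_antipathI: "distinct xs \<Longrightarrow> alternating r xs \<Longrightarrow> length xs = n \<Longrightarrow> has_antipath r n"
  by (auto simp: has_antipath_def)

text \<open>The arc assumed in \<open>out_ge\<close> and \<open>in_ge\<close> is the exception made
  for degree 0. The axioms are stable under \<open>opp\<close>, so each result on sources has a dual
  on sinks.\<close>

locale semidegree_relation =
  fixes r :: "'a \<Rightarrow> 'a \<Rightarrow> bool" and d :: nat
  assumes finite_rel: "finite {(u, v). r u v}"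
    and asym: "r u v \<Longrightarrow> \<not> r v u"
    and out_ge: "r u v \<Longrightarrow> d \<le> card {w. r u w}"
    and in_ge: "r u v \<Longrightarrow> d \<le> card {w. r w v}"
begin

lemma semidegree_relation_opp: "semidegree_relation (opp r) d"
proof
  have "{(u, v). opp r u v} = prod.swap ` {(u, v). r u v}" by (auto simp: opp_def)
  then show "finite {(u, v). opp r u v}" using finite_rel by simp
qed (auto simp: opp_def asym out_ge in_ge)

lemma irrefl: "\<not> r v v"
  using asym by blast

lemma finite_out: "finite {v. r u v}"
  by (rule finite_subset[OF _ finite_imageI[OF finite_rel, of snd]]) force

lemma finite_in: "finite {u. r u v}"
  by (rule finite_subset[OF _ finite_imageI[OF finite_rel, of fst]]) force

text \<open>By asymmetry the two neighbourhoods are disjoint, and neither contains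
  \<open>z\<close>.\<close>

lemma card_inside_out_in:
  assumes "distinct xs" "z \<in> set xs"
  shows "card {v \<in> set xs. r z v} + card {v \<in> set xs. r v z} \<le> length xs - 1"
proof -
  have "card {v \<in> set xs. r z v} + card {v \<in> set xs. r v z} =
        card ({v \<in> set xs. r z v} \<union> {v \<in> set xs. r v z})"
    by (rule card_Un_disjoint[symmetric]) (auto dest: asym)
  also have "\<dots> \<le> card (set xs - {z})"
    by (rule card_mono) (auto simp: irrefl)
  finally show ?thesis using assms by (simp add: distinct_card)
qed

lemma card_inside_ge:
  assumes "r u v" "card ({v. r u v} - set xs) \<le> e"
  shows "d - e \<le> card {v \<in> set xs. r u v}"
proof -
  have "card {v. r u v} \<le> card ({v. r u v} - set xs) + card ({v. r u v} \<inter> set xs)"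
    by (metis Diff_Int2 Un_Diff_Int card_Un_le)
  moreover have "{v. r u v} \<inter> set xs = {v \<in> set xs. r u v}" by auto
  ultimately show ?thesis using out_ge[OF assms(1)] assms(2) by simp
qed

text \<open>Otherwise more than \<open>e\<close> outside vertices have an arc to the head. As longer
  antipaths are missing, their out-neighbours stay on \<open>ys\<close> and exclude each other as in
  \<open>few_coattached\<close>, whose bound then contradicts the one on \<open>n\<close>.\<close>

lemma card_outside_in_le:
  assumes R: "distinct ys" "alternating (opp r) ys" "length ys = 2 * n + 1"
    and none: "\<not> has_antipath r (2 * n + 3)" "\<not> has_antipath (opp r) (2 * n + 3)"
    and d: "n + 1 + e \<le> d" and n: "n \<le> 2 * ((e + 1) * e)" and "1 \<le> e"
  shows "card ({w. r w (hd ys)} - set ys) \<le> e"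
proof (rule ccontr)
  define Z where "Z = {w. r w (hd ys)} - set ys"
  assume "\<not> ?thesis"
  then have card: "e + 1 \<le> card Z" by (simp add: Z_def)
  have hd: "hd ys = ys ! 0" and last: "last ys = ys ! (2 * n)" and "ys \<noteq> []"
    using R(3) hd_conv_nth[of ys] last_conv_nth[of ys] by force+
  have Z: "r w (ys ! 0)" "w \<notin> set ys" if "w \<in> Z" for w
    using that hd by (auto simp: Z_def)
  have alt: "alternating r (w # ys)" if "w \<in> Z" for w
    using Z[OF that] R(2) hd by (simp add: alternating_Cons)
  have no_last: "\<not> r w (ys ! (2 * n))" if w: "w \<in> Z" for w
  proof
    assume a: "r w (ys ! (2 * n))"
    have "finite Z" using finite_in by (simp add: Z_def)
    then have "card (Z - {w}) > 0" using card w \<open>1 \<le> e\<close> by simp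
    then obtain v where v: "v \<in> Z" "v \<noteq> w"
      by (metis Diff_iff card.empty ex_in_conv insertI1 less_irrefl)
    have "alternating r ((v # ys) @ [w])"
      unfolding alternating_append using alt[OF v(1)] a last \<open>ys \<noteq> []\<close> R(3) by (simp add: opp_def)
    moreover have "distinct ((v # ys) @ [w])"
      using v w R(1) Z(2) by auto
    moreover have "length ((v # ys) @ [w]) = 2 * n + 3" using R(3) by simp
    ultimately show False using none(1) has_antipathI by blast
  qed
  have confined: "v \<in> set ys" if w: "w \<in> Z" and "r w v" for v w
  proof (rule ccontr)
    assume "v \<notin> set ys"
    then have "distinct (v # w # ys)" using w that(2) Z(2) R(1) irrefl by auto
    moreover have "alternating (opp r) (v # w # ys)"
      using alt[OF w] that(2) by (simp add: alternating_Cons opp_def)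
    moreover have "length (v # w # ys) = 2 * n + 3" using R(3) by simp
    ultimately show False using none(2) has_antipathI by blast
  qed
  have excl: "\<not> r w (ys ! (2 * j + 1)) \<and> \<not> r w (ys ! (2 * j))"
    if vw: "v \<in> Z" "w \<in> Z" "v \<noteq> w" and j: "j < n"
      and vj: "r v (ys ! (2 * j + 1))" and wj: "r w (ys ! (2 * (Suc j)))" for v w j
  proof -
    \<comment> \<open>The source \<open>x\<close> is cut out of \<open>ys\<close>. Both pieces have
      sinks at their ends; rejoining them with \<open>v\<close>, \<open>w\<close> and
      \<open>x\<close> would give \<open>2 * n + 3\<close> vertices.\<close>
    define k where "k = 2 * j + 1"
    define x where "x = ys ! k"
    define as where "as = take k ys"
    define bs where "bs = drop (Suc k) ys"
    have k: "Suc k < length ys" and odd: "odd k" using j R(3) by (auto simp: k_def)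
    have ys: "ys = as @ x # bs"
      unfolding as_def bs_def x_def using k by (simp add: id_take_nth_drop)
    have len: "length as = k" and "as \<noteq> []" using k by (auto simp: as_def k_def)
    have "bs \<noteq> []" using k by (simp add: bs_def)
    have hd_as: "hd as = ys ! 0" using \<open>as \<noteq> []\<close> ys by (metis hd hd_append)
    have last_as: "last as = ys ! (2 * j)"
      using \<open>as \<noteq> []\<close> len ys
      by (metis One_nat_def add.right_neutral add_Suc_right add_diff_cancel_right' k_def last_conv_nth
          lessI nth_append)
    have hd_bs: "hd bs = ys ! (2 * Suc j)"
      using k by (simp add: bs_def hd_drop_conv_nth k_def)
    have alt_as: "alternating (opp r) as" and alt_bs: "alternating (opp r) bs"
      using R(2) len odd unfolding ys by (auto simp: alternating_append alternating_Cons)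
    have "length as + length bs = 2 * n" using R(3) ys by simp
    have r: "r v (hd as)" "r w (hd as)" "r w (hd bs)" "r v x"
      using Z(1) vw hd_as wj vj hd_bs by (auto simp: x_def k_def)
    have dist: "distinct as" "distinct bs" "x \<notin> set as" "x \<notin> set bs" "set as \<inter> set bs = {}"
      using R(1) unfolding ys by auto
    have new: "v \<notin> set as" "v \<notin> set bs" "v \<noteq> x" "w \<notin> set as" "w \<notin> set bs" "w \<noteq> x"
      using Z(2)[OF vw(1)] Z(2)[OF vw(2)] unfolding ys by auto
    have False if "r w x"
    proof -
      \<comment> \<open>\<open>x\<close> becomes a sink between \<open>v\<close> and \<open>w\<close>\<close>
      let ?zs = "rev as @ v # x # w # bs"
      have "alternating (opp r) ?zs"
        unfolding alternating_append alternating_rev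
        using alt_as alt_bs r that odd len \<open>as \<noteq> []\<close> \<open>bs \<noteq> []\<close>
        by (simp add: alternating_Cons last_rev opp_def)
      moreover have "distinct ?zs" using dist new vw(3) by auto
      moreover have "length ?zs = 2 * n + 3" using \<open>length as + length bs = 2 * n\<close> by simp
      ultimately show False using none(2) has_antipathI by blast
    qed
    moreover have False if "r w (last as)"
    proof -
      \<comment> \<open>\<open>w\<close> takes the place of \<open>x\<close>, which becomes an end\<close>
      let ?zs = "(x # v # as) @ w # bs"
      have "alternating (opp r) ?zs"
        unfolding alternating_append
        using alt_as alt_bs r that odd len \<open>as \<noteq> []\<close> \<open>bs \<noteq> []\<close>
        by (simp add: alternating_Cons opp_def)
      moreover have "distinct ?zs" using dist new vw(3) by auto
      moreover have "length ?zs = 2 * n + 3" using \<open>length as + length bs = 2 * n\<close> by simp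
      ultimately show False using none(2) has_antipathI by blast
    qed
    ultimately show ?thesis by (auto simp: x_def k_def last_as)
  qed
  have "n + 1 + e \<le> (\<Sum>j\<le>n. of_bool (r w (ys ! (2 * j)))) + (\<Sum>j<n. of_bool (r w (ys ! (2 * j + 1))))"
    if w: "w \<in> Z" for w
  proof -
    have "{v. r w v} = {v \<in> set ys. r w v}" using confined[OF w] by auto
    then show ?thesis
      using out_ge[OF Z(1)[OF w]] d card_filter_odd_even[OF R(1,3), of "r w"] by simp
  qed
  then have "2 * (card Z * e) < n"
    by (intro few_coattached[of Z "\<lambda>w j. r w (ys ! (2 * j))" n "\<lambda>w j. r w (ys ! (2 * j + 1))"])
      (use card \<open>1 \<le> e\<close> Z(1) no_last excl finite_in in \<open>auto simp: Z_def\<close>)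
  moreover have "(e + 1) * e \<le> card Z * e" using card by (rule mult_le_mono1)
  ultimately show False using n by simp
qed

text \<open>An outside out-neighbour of one end could replace the other end: attached as a sink, it
  gives the missing type on equally many vertices.\<close>

lemma outside_extension:
  assumes "distinct xs" "alternating r xs" "length xs = 2 * n + 1" "1 \<le> n"
    and none: "\<not> has_antipath (opp r) (2 * n + 1)"
  shows "{v. r (hd xs) v} \<subseteq> set xs" "{v. r (last xs) v} \<subseteq> set xs"
proof -
  have *: "{v. r (hd ys) v} \<subseteq> set ys"
    if ys: "distinct ys" "alternating r ys" "length ys = 2 * n + 1" for ys
  proof (rule subsetI, rule ccontr)
    fix v assume v: "v \<in> {v. r (hd ys) v}" "v \<notin> set ys"
    have "butlast ys \<noteq> []"
      using ys(3) assms(4) by (cases ys rule: remdups_adj.cases) auto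
    then have "hd (butlast ys) = hd ys"
      by (metis append_butlast_last_id butlast.simps(1) hd_append2)
    then have "alternating (opp r) (v # butlast ys)"
      using ys(2) v(1) by (auto simp: alternating_Cons alternating_butlast opp_def)
    moreover have "distinct (v # butlast ys)"
      using ys(1) v(2) by (auto simp: distinct_butlast dest: in_set_butlastD)
    moreover have "length (v # butlast ys) = 2 * n + 1" using ys(3) by simp
    ultimately show False using none has_antipathI by blast
  qed
  show "{v. r (hd xs) v} \<subseteq> set xs" by (rule *) fact+
  show "{v. r (last xs) v} \<subseteq> set xs"
    using *[of "rev xs"] assms by (simp add: alternating_rev hd_rev)
qed

lemma ex_out_of_ends:
  assumes "alternating r xs" "length xs = 2 * n + 1" "1 \<le> n"
  shows "\<exists>v. r (hd xs) v" "\<exists>v. r (last xs) v"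
proof -
  have *: "\<exists>v. r (hd ys) v" if "alternating r ys" "length ys = 2 * n + 1" for ys
    using that assms(3) by (cases ys rule: remdups_adj.cases) auto
  show "\<exists>v. r (hd xs) v" by (rule *) fact+
  show "\<exists>v. r (last xs) v"
    using *[of "rev xs"] assms by (simp add: alternating_rev hd_rev)
qed

text \<open>Each end keeps at least \<open>d - e\<close>, hence more than \<open>n\<close>,
  out-neighbours on the antipath.\<close>

lemma ex_closing:
  assumes xs: "distinct xs" "alternating r xs" "length xs = 2 * n + 1" "1 \<le> n"
    and e: "card ({v. r (hd xs) v} - set xs) \<le> e" "card ({v. r (last xs) v} - set xs) \<le> e"
    and d: "n + e < d"
  shows "\<exists>ys. distinct ys \<and> alternating r ys \<and> set ys = set xs \<and> length ys = length xs \<and>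
              r (hd ys) (last ys)"
proof -
  obtain u v where "r (hd xs) u" "r (last xs) v" using ex_out_of_ends[OF xs(2-4)] by blast
  then have "d - e \<le> card {v \<in> set xs. r (hd xs) v}" "d - e \<le> card {v \<in> set xs. r (last xs) v}"
    using card_inside_ge e by blast+
  then show ?thesis
    using d by (intro ex_closing_rotation[OF xs(1-3)]) (auto simp: irrefl)
qed

text \<open>If the other type is missing, both ends have all their out-neighbours on the antipath. A
  closing arc then exists, and moving its head to the front produces the other type.\<close>

lemma has_antipath_opp:
  assumes "has_antipath r (2 * n + 1)" "1 \<le> n" "n < d"
  shows "has_antipath (opp r) (2 * n + 1)"
proof (rule ccontr)
  assume none: "\<not> ?thesis"
  obtain xs where xs: "distinct xs" "alternating r xs" "length xs = 2 * n + 1"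
    using assms(1) by (auto simp: has_antipath_def)
  have "card ({v. r (hd xs) v} - set xs) \<le> 0" "card ({v. r (last xs) v} - set xs) \<le> 0"
    using outside_extension[OF xs assms(2) none] by (simp_all add: Diff_eq_empty_iff[THEN iffD2])
  then obtain ys where ys: "distinct ys" "alternating r ys" "length ys = 2 * n + 1" "r (hd ys) (last ys)"
    using ex_closing[OF xs assms(2), of 0] assms(3) xs(3) by auto
  then show False
    using alternating_last_Cons_butlast[OF ys(1,2)] none assms(2)
      has_antipathI[of "last ys # butlast ys" "opp r" "2 * n + 1"] by simp
qed

text \<open>Induction on half the length. The final \<open>+ 1\<close> in the bound is the gap
  between \<open>Suc n\<close> and the \<open>n\<close> to which \<open>card_outside_in_le\<close>
  is applied.\<close>

lemma has_antipath_even: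
  assumes "\<exists>u v. r u v" "1 \<le> n" "n < d" "n \<le> 2 * ((d - n + 1) * (d - n)) + 1"
  shows "has_antipath r (2 * n + 1) \<and> has_antipath (opp r) (2 * n + 1)"
  using assms(2-)
proof (induction n rule: nat_induct_at_least)
  case base
  obtain u v where uv: "r v u" using assms(1) by blast
  have "2 \<le> card {w. r v w}" using out_ge[OF uv] base by simp
  then have "card ({w. r v w} - {u}) > 0" using uv finite_out by simp
  then obtain w where w: "r v w" "w \<noteq> u"
    by (metis Diff_iff card.empty ex_in_conv insertI1 less_irrefl mem_Collect_eq)
  have 1: "has_antipath (opp r) (2 * 1 + 1)"
    by (rule has_antipathI[of "[u, v, w]"]) (use uv w irrefl in \<open>auto simp: opp_def\<close>)
  interpret O: semidegree_relation "opp r" d by (rule semidegree_relation_opp)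
  show ?case using 1 O.has_antipath_opp[OF 1] base by simp
next
  case (Suc n)
  interpret O: semidegree_relation "opp r" d by (rule semidegree_relation_opp)
  define e where "e = d - Suc n"
  have e: "1 \<le> e" "d = Suc n + e" using Suc.prems by (auto simp: e_def)
  have n: "n \<le> 2 * ((e + 1) * e)" using Suc.prems(2) by (simp add: e_def)
  also have "\<dots> \<le> 2 * ((e + 1 + 1) * (e + 1)) + 1" by (simp add: algebra_simps)
  finally have IH: "has_antipath r (2 * n + 1)"
    using Suc.IH Suc.prems e by simp
  show ?case
  proof (rule ccontr)
    assume "\<not> ?case"
    moreover have "n + 1 < d" using Suc.prems by simp
    ultimately have none: "\<not> has_antipath r (2 * n + 3)" "\<not> has_antipath (opp r) (2 * n + 3)"
      using has_antipath_opp[of "n + 1"] O.has_antipath_opp[of "n + 1"] Suc.hyps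
      by (auto simp: eval_nat_numeral)
    have outside_in: "card ({w. r w (hd ys)} - set ys) \<le> e"
      if "distinct ys" "alternating (opp r) ys" "length ys = 2 * n + 1" for ys
      using card_outside_in_le[OF that none] e n by simp
    have outside_out: "card ({w. r (hd ys) w} - set ys) \<le> e"
      if "distinct ys" "alternating r ys" "length ys = 2 * n + 1" for ys
      using O.card_outside_in_le[of ys n e] that none e n by (simp add: opp_def[of r])
    have outside_out': "card ({w. r (last ys) w} - set ys) \<le> e"
      if "distinct ys" "alternating r ys" "length ys = 2 * n + 1" for ys
      using outside_out[of "rev ys"] that by (simp add: alternating_rev hd_rev)
    obtain xs where xs: "distinct xs" "alternating r xs" "length xs = 2 * n + 1"
      using IH by (auto simp: has_antipath_def)
    obtain ys where ys: "distinct ys" "alternating r ys" "length ys = 2 * n + 1" "r (hd ys) (last ys)"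
      using ex_closing[OF xs Suc.hyps outside_out[OF xs] outside_out'[OF xs]] e xs(3) by auto
    define z where "z = last ys"
    define zs where "zs = z # butlast ys"
    have zs: "distinct zs" "alternating (opp r) zs" "set zs = set ys" "length zs = 2 * n + 1" "hd zs = z"
      using alternating_last_Cons_butlast[OF ys(1,2) _ ys(4)] ys(3) Suc.hyps
      by (auto simp: zs_def z_def)
    have "z \<in> set ys" using ys(3) by (cases ys) (auto simp: z_def)
    \<comment> \<open>Here \<open>d - e\<close> is \<open>n + 1\<close>, so \<open>z\<close> has at
      least \<open>n + 1\<close> neighbours in each direction among only \<open>2 * n\<close> other
      vertices.\<close>
    have "d - e \<le> card {v \<in> set ys. r z v}"
      using ex_out_of_ends(2)[OF ys(2,3) Suc.hyps] card_inside_ge outside_out'[OF ys(1-3)]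
      unfolding z_def by blast
    moreover have "d - e \<le> card {v \<in> set ys. r v z}"
      using O.card_inside_ge[of z "hd ys" ys e] outside_in[OF zs(1,2,4)] ys(4) zs(3,5)
      by (simp add: opp_def z_def)
    ultimately have "2 * (d - e) \<le> length ys - 1"
      using card_inside_out_in[OF ys(1) \<open>z \<in> set ys\<close>] by simp
    then show False using ys(3) e by simp
  qed
qed

text \<open>After closing, \<open>z\<close> has at least \<open>d\<close> out-neighbours among the
  \<open>2 * n\<close> other vertices, hence fewer than \<open>d\<close> in-neighbours there. An
  in-neighbour outside prolongs the antipath that starts with \<open>z\<close> as a sink.\<close>

lemma has_antipath_odd:
  assumes "has_antipath r (2 * n + 1)" "1 \<le> n" "n < d"
  shows "has_antipath r (2 * n + 2)"
proof (rule ccontr)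
  assume none: "\<not> ?thesis"
  have confined: "{v. r (last ys) v} \<subseteq> set ys"
    if ys: "distinct ys" "alternating r ys" "length ys = 2 * n + 1" for ys
  proof (rule subsetI, rule ccontr)
    fix v assume v: "v \<in> {v. r (last ys) v}" "v \<notin> set ys"
    have "alternating r (ys @ [v])" using v(1) ys(2,3) by (simp add: alternating_append)
    then show False using v(2) ys none has_antipathI[of "ys @ [v]"] by simp
  qed
  obtain xs where xs: "distinct xs" "alternating r xs" "length xs = 2 * n + 1"
    using assms(1) by (auto simp: has_antipath_def)
  have "card ({v. r (last xs) v} - set xs) \<le> 0" "card ({v. r (hd xs) v} - set xs) \<le> 0"
    using confined[OF xs] confined[of "rev xs"] xs by (simp_all add: alternating_rev last_rev Diff_eq_empty_iff[THEN iffD2])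
  then obtain ys where ys: "distinct ys" "alternating r ys" "length ys = 2 * n + 1" "r (hd ys) (last ys)"
    using ex_closing[OF xs assms(2), of 0] assms(3) xs(3) by auto
  define z where "z = last ys"
  define zs where "zs = z # butlast ys"
  have zs: "distinct zs" "alternating (opp r) zs" "set zs = set ys" "length zs = 2 * n + 1" "hd zs = z"
    using alternating_last_Cons_butlast[OF ys(1,2) _ ys(4)] ys(3) assms(2)
    by (auto simp: zs_def z_def)
  have "z \<in> set ys" using ys(3) by (cases ys) (auto simp: z_def)
  have "{v \<in> set ys. r z v} = {v. r z v}" using confined[OF ys(1-3)] by (auto simp: z_def)
  then have "d \<le> card {v \<in> set ys. r z v}"
    using ex_out_of_ends(2)[OF ys(2,3) assms(2)] out_ge by (auto simp: z_def)
  then have "card {v \<in> set ys. r v z} < d"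
    using card_inside_out_in[OF ys(1) \<open>z \<in> set ys\<close>] ys(3) assms(3) by simp
  also have "d \<le> card {v. r v z}" using in_ge ys(4) by (simp add: z_def)
  finally obtain w where w: "r w z" "w \<notin> set ys"
    by (metis (mono_tags, lifting) Collect_cong less_irrefl)
  have "alternating r (w # zs)" using w(1) zs by (simp add: alternating_Cons)
  then show False using w(2) zs none has_antipathI[of "w # zs"] by simp
qed

end

section \<open>Antipaths as subgraphs\<close>

lemma contains_copyI:
  assumes "pair_wf_digraph G" "pair_wf_digraph P"
    and "inj_on f (pverts P)" "f ` pverts P \<subseteq> pverts G"
    and arcs: "\<And>u v. (u, v) \<in> parcs P \<Longrightarrow> (f u, f v) \<in> parcs G"
  shows "contains_copy G P"
proof -
  interpret G: pair_wf_digraph G by fact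
  interpret P: pair_wf_digraph P by fact
  define H where "H = \<lparr>pverts = f ` pverts P, parcs = map_prod f f ` parcs P\<rparr>"
  have "wf_digraph (with_proj H)"
    by unfold_locales (auto simp: H_def dest: P.wellformed')
  then have "subgraph (with_proj H) (with_proj G)"
    using assms(4) arcs G.wf_digraph_axioms by (auto simp: subgraph_def compatible_def H_def)
  moreover have "digraph_iso (with_proj P) (with_proj H)"
    unfolding digraph_iso_def
  proof (intro exI conjI)
    let ?f = "\<lparr>iso_verts = f, iso_arcs = map_prod f f, iso_head = snd, iso_tail = fst\<rparr>"
    have "inj_on (map_prod f f) (pverts P \<times> pverts P)"
      using assms(3) assms(3) by (rule map_prod_inj_on)
    then have "inj_on (map_prod f f) (parcs P)"
      by (rule inj_on_subset) (auto dest: P.wellformed')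
    then show "pre_digraph.digraph_isomorphism (with_proj P) ?f"
      using assms(3) P.wf_digraph_axioms by (simp add: pre_digraph.digraph_isomorphism_def)
    show "with_proj H = app_iso ?f (with_proj P)"
      by (simp add: app_iso_def with_proj_def H_def)
  qed
  ultimately show ?thesis unfolding contains_copy_def by blast
qed

section \<open>Passing between oriented graphs and relations\<close>

lemma out_degree_conv_card: "out_degree (with_proj G) v = card {w. (v, w) \<in> parcs G}"
proof -
  have "out_arcs (with_proj G) v = Pair v ` {w. (v, w) \<in> parcs G}" by (auto simp: out_arcs_def)
  then show ?thesis by (simp add: out_degree_def card_image inj_on_def)
qed

lemma in_degree_conv_card: "in_degree (with_proj G) v = card {u. (u, v) \<in> parcs G}"
proof -
  have "in_arcs (with_proj G) v = (\<lambda>u. (u, v)) ` {u. (u, v) \<in> parcs G}" by (auto simp: in_arcs_def)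
  then show ?thesis by (simp add: in_degree_def card_image inj_on_def)
qed

context oriented_graph
begin

lemma out_degree_pos: "(u, v) \<in> parcs G \<Longrightarrow> out_degree G u \<noteq> 0"
proof -
  have "finite {w. (u, w) \<in> parcs G}"
    by (rule finite_subset[OF _ finite_imageI[OF pair_finite_arcs, of snd]]) force
  then show "(u, v) \<in> parcs G \<Longrightarrow> out_degree G u \<noteq> 0" unfolding out_degree_conv_card by auto
qed

lemma in_degree_pos: "(u, v) \<in> parcs G \<Longrightarrow> in_degree G v \<noteq> 0"
proof -
  have "finite {w. (w, v) \<in> parcs G}"
    by (rule finite_subset[OF _ finite_imageI[OF pair_finite_arcs, of fst]]) force
  then show "(u, v) \<in> parcs G \<Longrightarrow> in_degree G v \<noteq> 0" unfolding in_degree_conv_card by auto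
qed

lemma semidegree_relation_min_pseudo_semidegree:
  "semidegree_relation (\<lambda>u v. (u, v) \<in> parcs G) (min_pseudo_semidegree G)"
proof
  show "finite {(u, v). (u, v) \<in> parcs G}" using pair_finite_arcs by simp
next
  fix u v assume uv: "(u, v) \<in> parcs G"
  then show "(v, u) \<notin> parcs G" by (rule no_opposite_arcs)
  have "pseudo_semidegree_ge G (min_pseudo_semidegree G)"
    using le_min_pseudo_semidegree_iff uv by blast
  with out_degree_pos[OF uv] in_degree_pos[OF uv] in_arcsD1[OF uv] in_arcsD2[OF uv]
  show "min_pseudo_semidegree G \<le> card {w. (u, w) \<in> parcs G}"
    "min_pseudo_semidegree G \<le> card {w. (w, v) \<in> parcs G}"
    by (auto simp: pseudo_semidegree_ge_def simp flip: out_degree_conv_card in_degree_conv_card)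
qed

end

text \<open>No vertex has both an incoming and an outgoing arc, so consecutive edges point in
  opposite directions and the first edge determines all others.\<close>

lemma antipath_alternating:
  assumes "antipath k P" "1 \<le> k"
  obtains p where "oriented_graph P" "distinct p" "length p = Suc k" "pverts P = set p"
    "{{u, v} | u v. (u, v) \<in> parcs P} = {{p ! i, p ! Suc i} | i. Suc i < length p}"
    "alternating (\<lambda>u v. (u, v) \<in> parcs P) p \<or> alternating (opp (\<lambda>u v. (u, v) \<in> parcs P)) p"
proof -
  let ?r = "\<lambda>u v. (u, v) \<in> parcs P"
  obtain p where p: "oriented_graph P" "distinct p" "length p = Suc k" "pverts P = set p"
    and edges: "{{u, v} | u v. (u, v) \<in> parcs P} = {{p ! i, p ! Suc i} | i. Suc i < length p}"
    and deg: "\<And>v. v \<in> pverts P \<Longrightarrow> in_degree P v = 0 \<or> out_degree P v = 0"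
    using assms(1) by (auto simp: antipath_def is_orientation_of_path_def)
  interpret P: oriented_graph P by fact
  have adj: "?r (p ! i) (p ! Suc i) \<or> ?r (p ! Suc i) (p ! i)" if "Suc i < length p" for i
  proof -
    have "{p ! i, p ! Suc i} \<in> {{u, v} | u v. (u, v) \<in> parcs P}" using that edges by blast
    then show ?thesis by (auto simp: doubleton_eq_iff)
  qed
  have no_pass: "\<not> (?r u v \<and> ?r v w)" for u v w
    using deg[of v] P.in_degree_pos P.out_degree_pos P.wellformed' by blast
  have alt: "alternating s p" if s: "s = ?r \<or> s = opp ?r" "s (p ! 0) (p ! 1)" for s
    unfolding alternating_iff_nth
  proof (intro allI impI)
    fix i assume "Suc i < length p"
    then show "orient s i (p ! i) (p ! Suc i)"
    proof (induction i)
      case (Suc i)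
      then have "orient s i (p ! i) (p ! Suc i)" by simp
      then show ?case
        using adj[OF Suc.prems] no_pass s(1)
        by (cases "even i") (auto simp: opp_def)
    qed (use s(2) in simp)
  qed
  have "?r (p ! 0) (p ! 1) \<or> opp ?r (p ! 0) (p ! 1)"
    using adj[of 0] p(3) assms(2) by (auto simp: opp_def)
  then have "alternating ?r p \<or> alternating (opp ?r) p" using alt by blast
  with p edges that show thesis by blast
qed

lemma contains_copy_alternating:
  assumes "oriented_graph G" "oriented_graph P"
    and p: "distinct p" "pverts P = set p"
      "{{u, v} | u v. (u, v) \<in> parcs P} = {{p ! i, p ! Suc i} | i. Suc i < length p}"
      "alternating s p"
    and q: "distinct q" "alternating t q" "length q = length p" "2 \<le> length q"
    and st: "s = (\<lambda>u v. (u, v) \<in> parcs P) \<and> t = (\<lambda>u v. (u, v) \<in> parcs G) \<or>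
             s = opp (\<lambda>u v. (u, v) \<in> parcs P) \<and> t = opp (\<lambda>u v. (u, v) \<in> parcs G)"
  shows "contains_copy G P"
proof -
  interpret G: oriented_graph G by fact
  interpret P: oriented_graph P by fact
  define f where "f v = q ! (THE i. i < length p \<and> p ! i = v)" for v
  have f: "f (p ! i) = q ! i" if "i < length p" for i
  proof -
    have "(THE j. j < length p \<and> p ! j = p ! i) = i"
      using that p(1) by (auto simp: nth_eq_iff_index_eq)
    then show ?thesis by (simp add: f_def)
  qed
  have q_step: "orient t i (q ! i) (q ! Suc i)" and p_step: "orient s i (p ! i) (p ! Suc i)"
    if "Suc i < length p" for i
    using p(4) q(2,3) that by (auto simp: alternating_iff_nth)
  show ?thesis
  proof (rule contains_copyI)
    show "pair_wf_digraph G" "pair_wf_digraph P" by unfold_locales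
    show "inj_on f (pverts P)"
      using p(1,2) q(1,3) f by (auto simp: inj_on_def in_set_conv_nth nth_eq_iff_index_eq)
    have "q ! i \<in> pverts G" if i: "i < length q" for i
    proof (cases "Suc i < length q")
      case True
      then show ?thesis
        using q_step[of i] q(3) st G.wellformed' by (auto simp: orient_def opp_def split: if_splits)
    next
      case False
      then obtain j where "i = Suc j" "Suc j < length p" using i q(3,4) by (cases i) auto
      then show ?thesis
        using q_step[of j] st G.wellformed' by (auto simp: orient_def opp_def split: if_splits)
    qed
    then show "f ` pverts P \<subseteq> pverts G" using p(2) q(3) f by (auto simp: in_set_conv_nth)
    fix u v assume uv: "(u, v) \<in> parcs P"
    then have "{u, v} \<in> {{p ! i, p ! Suc i} | i. Suc i < length p}" using p(3) by blast
    then obtain i where i: "Suc i < length p" and "u = p ! i \<and> v = p ! Suc i \<or> u = p ! Suc i \<and> v = p ! i"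
      by (auto simp: doubleton_eq_iff)
    \<comment> \<open>As \<open>P\<close> has no opposite arcs, the arc is the one that the
      alternation prescribes on this edge.\<close>
    then show "(f u, f v) \<in> parcs G"
      using uv p_step[OF i] q_step[OF i] st f[of i] f[of "Suc i"] P.no_opposite_arcs
      by (cases "even i") (auto simp: opp_def)
  qed
qed

text \<open>With \<open>e = d - k div 2\<close> the assumption gives
  \<open>sqrt (k - 3) < 2 * e + 1\<close>. Squaring yields \<open>k < 4 * (e + 1) * e + 4\<close>,
  and halving gives the second claim.\<close>

lemma semidegree_bound:
  assumes "4 \<le> k" "(real k - 1 + sqrt (real k - 3)) / 2 < real d"
  shows "k div 2 < d" "k div 2 \<le> 2 * ((d - k div 2 + 1) * (d - k div 2)) + 1"
proof -
  have "1 \<le> sqrt (real k - 3)" using assms(1) by simp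
  moreover have "real k - 1 + sqrt (real k - 3) < 2 * real d" using assms(2) by simp
  ultimately have less: "k < 2 * d" by linarith
  then show n: "k div 2 < d" by linarith
  define e where "e = d - k div 2"
  have "sqrt (real k - 3) < 2 * real d - real k + 1" using assms(2) by (simp add: field_simps)
  then have "(sqrt (real k - 3))\<^sup>2 < (2 * real d - real k + 1)\<^sup>2"
    using \<open>1 \<le> sqrt (real k - 3)\<close> by (intro power_strict_mono) auto
  then have sq: "real k - 3 < (2 * real d - real k + 1)\<^sup>2" using assms(1) by simp
  also have "\<dots> \<le> (2 * real e + 1)\<^sup>2"
  proof (rule power_mono)
    have "2 * d + 1 \<le> 2 * e + 1 + k" using n by (simp add: e_def)
    then show "2 * real d - real k + 1 \<le> 2 * real e + 1" by linarith
    show "0 \<le> 2 * real d - real k + 1" using less by linarith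
  qed
  finally have "real k - 3 < real ((2 * e + 1)\<^sup>2)" by (simp add: add.commute)
  then have "k < (2 * e + 1)\<^sup>2 + 3" by linarith
  then have "k < (2 * ((e + 1) * e) + 2) * 2" by (simp add: power2_eq_square algebra_simps)
  then have "k div 2 < 2 * ((e + 1) * e) + 2" by (rule less_mult_imp_div_less)
  then show "k div 2 \<le> 2 * ((d - k div 2 + 1) * (d - k div 2)) + 1" unfolding e_def[symmetric] by linarith
qed

theorem theorem1p3:
  fixes k :: nat and G :: "'a pair_pre_digraph" and P :: "'b pair_pre_digraph"
  assumes "k \<ge> 4"
    and "oriented_graph G"
    and "real (min_pseudo_semidegree G) > (real k - 1 + sqrt (real k - 3)) / 2"
    and "antipath k P"
  shows "contains_copy G P"
proof -
  let ?r = "\<lambda>u v. (u, v) \<in> parcs G" and ?d = "min_pseudo_semidegree G" and ?n = "k div 2"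
  interpret G: oriented_graph G by fact
  interpret R: semidegree_relation ?r ?d by (rule G.semidegree_relation_min_pseudo_semidegree)
  interpret O: semidegree_relation "opp ?r" ?d by (rule R.semidegree_relation_opp)
  note d = semidegree_bound[OF assms(1,3)]
  \<comment> \<open>Without arcs the parameter would have its default value 0.\<close>
  have "parcs G \<noteq> {}" using d(1) by (auto simp: min_pseudo_semidegree_def)
  moreover have n: "1 \<le> ?n" using assms(1) by linarith
  ultimately have even: "has_antipath ?r (2 * ?n + 1)" "has_antipath (opp ?r) (2 * ?n + 1)"
    using R.has_antipath_even[OF _ n d] by auto
  then have odd: "has_antipath ?r (2 * ?n + 2)" "has_antipath (opp ?r) (2 * ?n + 2)"
    using R.has_antipath_odd O.has_antipath_odd d(1) n by auto
  have "Suc k = 2 * ?n + 1 \<or> Suc k = 2 * ?n + 2" by linarith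
  then have "has_antipath ?r (Suc k)" "has_antipath (opp ?r) (Suc k)" using even odd by auto
  then obtain q q' where q: "length q = Suc k" "distinct q" "alternating ?r q"
    and q': "length q' = Suc k" "distinct q'" "alternating (opp ?r) q'"
    by (auto simp: has_antipath_def)
  obtain p where p: "oriented_graph P" "distinct p" "length p = Suc k" "pverts P = set p"
    "{{u, v} | u v. (u, v) \<in> parcs P} = {{p ! i, p ! Suc i} | i. Suc i < length p}"
    "alternating (\<lambda>u v. (u, v) \<in> parcs P) p \<or> alternating (opp (\<lambda>u v. (u, v) \<in> parcs P)) p"
    by (rule antipath_alternating[OF assms(4)]) (use assms(1) in auto)
  from p(6) show ?thesis
  proof
    assume "alternating (\<lambda>u v. (u, v) \<in> parcs P) p"
    then show ?thesis
      using contains_copy_alternating[OF assms(2) p(1,2,4,5) _ q(2,3)] q(1) p(3) assms(1) by simp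
  next
    assume "alternating (opp (\<lambda>u v. (u, v) \<in> parcs P)) p"
    then show ?thesis
      using contains_copy_alternating[OF assms(2) p(1,2,4,5) _ q'(2,3)] q'(1) p(3) assms(1) by simp
  qed
qed

end
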